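(* Let $\varphi$ be a pseudomultiplier of a Hilbert function space $\mathcal H$. Then $\varphi$ is locally bounded on $\mathbf D_\varphi^-$ (the closure in $\mathcal H$ of the set $\mathbf D_\varphi$ of definable vectors of $\varphi$) if and only if $\varphi$ has no polar vectors.
   Context: A Hilbert function space on a set $\Omega$ is a complex Hilbert space $\mathcal H$ whose elements are complex-valued functions on $\Omega$ (with pointwise operations) such that for each $\lambda\in\Omega$ the functional $f\mapsto f(\lambda)$ is continuous. A subset $D\subset\Omega$ is a set of uniqueness for $\mathcal H$ if any $f,g\in\mathcal H$ that agree on $D$ are equal. A function $\varphi:D_\varphi\subset\Omega\to\mathbb C$ is a pseudomultiplier of $\mathcal H$ if (1) $D_\varphi$ is a set of uniqueness for $\mathcal H$; (2) $E_\varphi=\{h\in\mathcal H:\text{ there exists } g\in\mathcal H \text{ with } g(\lambda)=\varphi(\lambda)h(\lambda)\text{ for all }\lambda\in D_\varphi\}$ is closed in $\mathcal H$; (3) $E_\varphi$ has finite codimension in $\mathcal H$. Seeing a vector: for $v\in\mathcal H$, let $p\notin\Omega$, and for $f\in\mathcal H$ define $f_v:\Omega\cup\{p\}\to\mathbb C$ by $f_v=f$ on $\Omega$ and $f_v(p)=\langle f,v\rangle$. Let $\mathcal H_v=\{f_v:f\in\mathcal H\}$ with $\langle f_v,g_v\rangle_{\mathcal H_v}=\langle f,g\rangle_{\mathcal H}$; this is a Hilbert function space on $\Omega\cup\{p\}$. The pseudomultiplier $\varphi$ of $\mathcal H$ sees $v$ with value $c\in\mathbb C$ if there exists a pseudomultiplier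 $\psi$ of $\mathcal H_v$ such that $D_\varphi\subseteq D_\psi$, $\psi|D_\varphi=\varphi$, $p\in D_\psi$, $E_\varphi=E_\psi|\Omega:=\{F|\Omega:F\in E_\psi\}$, and $\psi(p)=c$. $\varphi$ sees $v$ if it sees $v$ with some value $c$. Ambiguous vectors: $\mathcal A_\varphi$ is the set of $v\in\mathcal H$ such that $\varphi$ sees $v$ with value $c$ for every $c\in\mathbb C$. Definable vectors: $d\in\mathcal H$ is definable for $\varphi$ if $d\neq0$, $\varphi$ sees $d$, and $d\perp\mathcal A_\varphi$; $\mathbf D_\varphi$ is the set of definable vectors. For $d\in\mathbf D_\varphi$ there is a unique $c\in\mathbb C$ such that $\varphi$ sees $d$ with value $c$; it is denoted $\varphi(d)$, so $\varphi$ is regarded as a function on $\mathbf D_\varphi$. Polar vectors: $q\in\mathcal H$ is a polar vector for $\varphi$ if $q\ne0$ and there is a sequence $(d_n)$ in $\mathbf D_\varphi$ with $d_n\to q$ in norm and $\varphi(d_n)\to\infty$ (i.e. $|\varphi(d_n)|\to\infty$). $\varphi$ is locally bounded on $\mathbf D_\varphi^-$ if for every $d\in\mathbf D_\varphi^-$ there is a neighbourhood $U$ of $d$ in $\mathcal H$ such that $\varphi$ is bounded on $U\cap\mathbf D_\varphi$. *)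

theory Defs
  imports "HOL-Analysis.Analysis" "HOL-Library.Function_Algebras"
begin

text \<open>
  The vector space structure on functions is the pointwise one: addition and zero come from
  \<^theory>\<open>HOL-Library.Function_Algebras\<close>, scalar multiplication is \<open>fun_scale\<close>.
\<close>

definition fun_scale :: "complex \<Rightarrow> ('a \<Rightarrow> complex) \<Rightarrow> 'a \<Rightarrow> complex" where
  "fun_scale c f = (\<lambda>x. c * f x)"

interpretation cfun: vector_space fun_scale
  by standard (auto simp: fun_scale_def fun_eq_iff algebra_simps)

text \<open>
  A Hilbert function space is given by its underlying set \<open>H\<close> and an inner product \<open>ip\<close>, linear in
  the first argument; \<open>ip\<close> is relevant only on \<open>H\<close>. A function on \<open>\<Omega>\<close> is represented by its
  extension by zero to the whole type.

  The distance is set to zero off \<open>H\<close>, because \<^locale>\<open>Metric_space\<close> demands nonnegativity and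
  symmetry of the distance on the whole type and \<open>ip\<close> is arbitrary there.
\<close>

definition hfs_dist ::
    "('a \<Rightarrow> complex) set \<Rightarrow> (('a \<Rightarrow> complex) \<Rightarrow> ('a \<Rightarrow> complex) \<Rightarrow> complex)
      \<Rightarrow> ('a \<Rightarrow> complex) \<Rightarrow> ('a \<Rightarrow> complex) \<Rightarrow> real" where
  "hfs_dist H ip f g = (if f \<in> H \<and> g \<in> H then sqrt (Re (ip (f - g) (f - g))) else 0)"

definition hfs_topology ::
    "('a \<Rightarrow> complex) set \<Rightarrow> (('a \<Rightarrow> complex) \<Rightarrow> ('a \<Rightarrow> complex) \<Rightarrow> complex)
      \<Rightarrow> ('a \<Rightarrow> complex) topology" where
  "hfs_topology H ip = Metric_space.mtopology H (hfs_dist H ip)"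

locale hilbert_function_space =
  fixes \<Omega> :: "'a set"
    and H :: "('a \<Rightarrow> complex) set"
    and ip :: "('a \<Rightarrow> complex) \<Rightarrow> ('a \<Rightarrow> complex) \<Rightarrow> complex"
  assumes zero_outside: "\<And>f x. f \<in> H \<Longrightarrow> x \<notin> \<Omega> \<Longrightarrow> f x = 0"
    and subspace: "cfun.subspace H"
    and ip_add: "\<And>f g h. f \<in> H \<Longrightarrow> g \<in> H \<Longrightarrow> h \<in> H \<Longrightarrow> ip (f + g) h = ip f h + ip g h"
    and ip_scale: "\<And>c f g. f \<in> H \<Longrightarrow> g \<in> H \<Longrightarrow> ip (fun_scale c f) g = c * ip f g"
    and ip_cnj: "\<And>f g. f \<in> H \<Longrightarrow> g \<in> H \<Longrightarrow> ip g f = cnj (ip f g)"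
    and ip_pos: "\<And>f. f \<in> H \<Longrightarrow> f \<noteq> 0 \<Longrightarrow> 0 < Re (ip f f)"
    and complete: "Metric_space.mcomplete H (hfs_dist H ip)"
    and continuous_eval:
      "\<And>x. x \<in> \<Omega> \<Longrightarrow> continuous_map (hfs_topology H ip) euclidean (\<lambda>f. f x)"

definition set_of_uniqueness :: "'a set \<Rightarrow> ('a \<Rightarrow> complex) set \<Rightarrow> 'a set \<Rightarrow> bool" where
  "set_of_uniqueness \<Omega> H D \<longleftrightarrow>
     D \<subseteq> \<Omega> \<and> (\<forall>f\<in>H. \<forall>g\<in>H. (\<forall>x\<in>D. f x = g x) \<longrightarrow> f = g)"

definition finite_codim :: "('a \<Rightarrow> complex) set \<Rightarrow> ('a \<Rightarrow> complex) set \<Rightarrow> bool" where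
  "finite_codim H E \<longleftrightarrow> (\<exists>B. finite B \<and> B \<subseteq> H \<and> cfun.span (E \<union> B) = H)"

text \<open>A pseudomultiplier is a partial function \<open>\<phi>\<close>; its domain \<^term>\<open>dom \<phi>\<close> is $D_\varphi$.\<close>

definition pm_E :: "('a \<Rightarrow> complex) set \<Rightarrow> ('a \<rightharpoonup> complex) \<Rightarrow> ('a \<Rightarrow> complex) set" where
  "pm_E H \<phi> = {h \<in> H. \<exists>g\<in>H. \<forall>x\<in>dom \<phi>. g x = the (\<phi> x) * h x}"

definition pseudomultiplier ::
    "'a set \<Rightarrow> ('a \<Rightarrow> complex) set \<Rightarrow> (('a \<Rightarrow> complex) \<Rightarrow> ('a \<Rightarrow> complex) \<Rightarrow> complex)
      \<Rightarrow> ('a \<rightharpoonup> complex) \<Rightarrow> bool" where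
  "pseudomultiplier \<Omega> H ip \<phi> \<longleftrightarrow>
     set_of_uniqueness \<Omega> H (dom \<phi>) \<and>
     closedin (hfs_topology H ip) (pm_E H \<phi>) \<and>
     finite_codim H (pm_E H \<phi>)"

text \<open>
  The set $\Omega \cup \{p\}$ with $p \notin \Omega$ is modelled inside the option type, with
  \<^term>\<open>None\<close> as the new point \<open>p\<close>. Restriction of \<open>F\<close> to \<open>\<Omega>\<close> is then \<^term>\<open>F \<circ> Some\<close>.
\<close>

definition ext_points :: "'a set \<Rightarrow> 'a option set" where
  "ext_points \<Omega> = insert None (Some ` \<Omega>)"

definition ext_fun ::
    "(('a \<Rightarrow> complex) \<Rightarrow> ('a \<Rightarrow> complex) \<Rightarrow> complex) \<Rightarrow> ('a \<Rightarrow> complex)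
      \<Rightarrow> ('a \<Rightarrow> complex) \<Rightarrow> 'a option \<Rightarrow> complex" where
  "ext_fun ip v f = (\<lambda>y. case y of None \<Rightarrow> ip f v | Some x \<Rightarrow> f x)"

definition ext_space ::
    "('a \<Rightarrow> complex) set \<Rightarrow> (('a \<Rightarrow> complex) \<Rightarrow> ('a \<Rightarrow> complex) \<Rightarrow> complex)
      \<Rightarrow> ('a \<Rightarrow> complex) \<Rightarrow> ('a option \<Rightarrow> complex) set" where
  "ext_space H ip v = ext_fun ip v ` H"

definition ext_ip ::
    "(('a \<Rightarrow> complex) \<Rightarrow> ('a \<Rightarrow> complex) \<Rightarrow> complex)
      \<Rightarrow> ('a option \<Rightarrow> complex) \<Rightarrow> ('a option \<Rightarrow> complex) \<Rightarrow> complex" where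
  "ext_ip ip F G = ip (F \<circ> Some) (G \<circ> Some)"

definition sees_with_value ::
    "'a set \<Rightarrow> ('a \<Rightarrow> complex) set \<Rightarrow> (('a \<Rightarrow> complex) \<Rightarrow> ('a \<Rightarrow> complex) \<Rightarrow> complex)
      \<Rightarrow> ('a \<rightharpoonup> complex) \<Rightarrow> ('a \<Rightarrow> complex) \<Rightarrow> complex \<Rightarrow> bool" where
  "sees_with_value \<Omega> H ip \<phi> v c \<longleftrightarrow> v \<in> H \<and>
     (\<exists>\<psi>. pseudomultiplier (ext_points \<Omega>) (ext_space H ip v) (ext_ip ip) \<psi> \<and>
          Some ` dom \<phi> \<subseteq> dom \<psi> \<and>
          (\<forall>x\<in>dom \<phi>. \<psi> (Some x) = \<phi> x) \<and>
          pm_E H \<phi> = (\<lambda>F. F \<circ> Some) ` pm_E (ext_space H ip v) \<psi> \<and>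
          \<psi> None = Some c)"

definition sees ::
    "'a set \<Rightarrow> ('a \<Rightarrow> complex) set \<Rightarrow> (('a \<Rightarrow> complex) \<Rightarrow> ('a \<Rightarrow> complex) \<Rightarrow> complex)
      \<Rightarrow> ('a \<rightharpoonup> complex) \<Rightarrow> ('a \<Rightarrow> complex) \<Rightarrow> bool" where
  "sees \<Omega> H ip \<phi> v \<longleftrightarrow> (\<exists>c. sees_with_value \<Omega> H ip \<phi> v c)"

definition ambiguous_vectors ::
    "'a set \<Rightarrow> ('a \<Rightarrow> complex) set \<Rightarrow> (('a \<Rightarrow> complex) \<Rightarrow> ('a \<Rightarrow> complex) \<Rightarrow> complex)
      \<Rightarrow> ('a \<rightharpoonup> complex) \<Rightarrow> ('a \<Rightarrow> complex) set" where
  "ambiguous_vectors \<Omega> H ip \<phi> = {v \<in> H. \<forall>c. sees_with_value \<Omega> H ip \<phi> v c}"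

definition definable_vectors ::
    "'a set \<Rightarrow> ('a \<Rightarrow> complex) set \<Rightarrow> (('a \<Rightarrow> complex) \<Rightarrow> ('a \<Rightarrow> complex) \<Rightarrow> complex)
      \<Rightarrow> ('a \<rightharpoonup> complex) \<Rightarrow> ('a \<Rightarrow> complex) set" where
  "definable_vectors \<Omega> H ip \<phi> =
     {d \<in> H. d \<noteq> 0 \<and> sees \<Omega> H ip \<phi> d \<and> (\<forall>v\<in>ambiguous_vectors \<Omega> H ip \<phi>. ip d v = 0)}"

text \<open>The value $\varphi(d)$ at a definable vector \<open>d\<close>, where the described number is unique.\<close>

definition vector_value ::
    "'a set \<Rightarrow> ('a \<Rightarrow> complex) set \<Rightarrow> (('a \<Rightarrow> complex) \<Rightarrow> ('a \<Rightarrow> complex) \<Rightarrow> complex)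
      \<Rightarrow> ('a \<rightharpoonup> complex) \<Rightarrow> ('a \<Rightarrow> complex) \<Rightarrow> complex" where
  "vector_value \<Omega> H ip \<phi> d = (THE c. sees_with_value \<Omega> H ip \<phi> d c)"

definition polar_vector ::
    "'a set \<Rightarrow> ('a \<Rightarrow> complex) set \<Rightarrow> (('a \<Rightarrow> complex) \<Rightarrow> ('a \<Rightarrow> complex) \<Rightarrow> complex)
      \<Rightarrow> ('a \<rightharpoonup> complex) \<Rightarrow> ('a \<Rightarrow> complex) \<Rightarrow> bool" where
  "polar_vector \<Omega> H ip \<phi> q \<longleftrightarrow> q \<in> H \<and> q \<noteq> 0 \<and>
     (\<exists>d :: nat \<Rightarrow> 'a \<Rightarrow> complex.
        (\<forall>n. d n \<in> definable_vectors \<Omega> H ip \<phi>) \<and>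
        limitin (hfs_topology H ip) d q sequentially \<and>
        filterlim (\<lambda>n. vector_value \<Omega> H ip \<phi> (d n)) at_infinity sequentially)"

definition locally_bounded_on ::
    "'a set \<Rightarrow> ('a \<Rightarrow> complex) set \<Rightarrow> (('a \<Rightarrow> complex) \<Rightarrow> ('a \<Rightarrow> complex) \<Rightarrow> complex)
      \<Rightarrow> ('a \<rightharpoonup> complex) \<Rightarrow> ('a \<Rightarrow> complex) set \<Rightarrow> bool" where
  "locally_bounded_on \<Omega> H ip \<phi> S \<longleftrightarrow>
     (\<forall>d\<in>S. \<exists>U. openin (hfs_topology H ip) U \<and> d \<in> U \<and>
        bounded (vector_value \<Omega> H ip \<phi> ` (U \<inter> definable_vectors \<Omega> H ip \<phi>)))"

end

theory Submission
  imports Defs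
begin

text \<open>
  Write \<open>E\<close> for \<^term>\<open>pm_E H \<phi>\<close> and \<open>M : E \<rightarrow> H\<close> for multiplication by \<open>\<phi>\<close>. A vector
  \<open>v\<close> is seen with value \<open>c\<close> exactly if \<open>\<langle>M h, v\<rangle> = c \<langle>h, v\<rangle>\<close> for all \<open>h \<in> E\<close>
  (\<open>sees_with_value_iff\<close>), a linear condition on \<open>v\<close> for fixed \<open>c\<close>. Hence a nonzero
  multiple of a definable vector is definable with the same value, and every neighbourhood of \<open>0\<close>
  contains definable vectors with every value of \<open>\<phi>\<close> on such vectors. So local boundedness at \<open>0\<close> is
  boundedness on all definable vectors, and the content of the theorem is that, if the values are
  unbounded, then there is a nonzero limit along which they tend to infinity
  (\<open>polar_vector_if_unbounded\<close>).

  To find it, take definable unit vectors \<open>d\<^sub>n\<close> with values \<open>c\<^sub>n \<rightarrow> \<infinity>\<close>. For fixed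
  \<open>h \<in> E\<close> the numbers \<open>c\<^sub>n \<langle>h, d\<^sub>n\<rangle> = \<langle>M h, d\<^sub>n\<rangle>\<close> are bounded in \<open>n\<close>, so the
  uniform boundedness principle on the complete space \<open>E\<close> gives a constant \<open>K\<close> with
  \<open>|c\<^sub>n| |\<langle>h, d\<^sub>n\<rangle>| \<le> K \<parallel>h\<parallel>\<close>. The functionals
  \<open>\<langle>\<cdot>, d\<^sub>n\<rangle>\<close> therefore tend to zero in norm on \<open>E\<close>. What remains of \<open>d\<^sub>n\<close> lives in a
  complement of finite dimension, where bounded sequences are relatively compact
  (\<open>finite_codim_convergent_subsequence\<close>). A subsequence of \<open>d\<^sub>n\<close> then converges in norm, and its
  limit is a unit vector, hence polar.
\<close>

section \<open>Inner product geometry of a Hilbert function space\<close>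

context hilbert_function_space
begin

lemma zero_in [simp]: "0 \<in> H"
  using subspace by (rule cfun.subspace_0)

lemma add_in [intro, simp]: "f \<in> H \<Longrightarrow> g \<in> H \<Longrightarrow> f + g \<in> H"
  using subspace by (rule cfun.subspace_add)

lemma diff_in [intro, simp]: "f \<in> H \<Longrightarrow> g \<in> H \<Longrightarrow> f - g \<in> H"
  using subspace by (rule cfun.subspace_diff)

lemma scale_in [intro, simp]: "f \<in> H \<Longrightarrow> fun_scale c f \<in> H"
  using subspace by (rule cfun.subspace_scale)

lemma ip_zero_left [simp]: "g \<in> H \<Longrightarrow> ip 0 g = 0"
  using ip_scale[of 0 g 0] by simp

lemma ip_diff:
  assumes "f \<in> H" "g \<in> H" "h \<in> H"
  shows "ip (f - g) h = ip f h - ip g h"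
proof -
  have "ip (f - g + g) h = ip (f - g) h + ip g h"
    using assms by (intro ip_add) auto
  then show ?thesis by simp
qed

lemma ip_zero_right [simp]: "g \<in> H \<Longrightarrow> ip g 0 = 0"
  using ip_cnj[of 0 g] by simp

lemma ip_diff_right:
  assumes "f \<in> H" "g \<in> H" "h \<in> H"
  shows "ip h (f - g) = ip h f - ip h g"
  using assms ip_cnj[of "f - g" h] ip_cnj[of f h] ip_cnj[of g h] by (simp add: ip_diff)

lemma ip_add_right:
  assumes "f \<in> H" "g \<in> H" "h \<in> H"
  shows "ip h (f + g) = ip h f + ip h g"
  using assms ip_cnj[of "f + g" h] ip_cnj[of f h] ip_cnj[of g h] by (simp add: ip_add)

lemma ip_scale_right:
  assumes "f \<in> H" "g \<in> H"
  shows "ip f (fun_scale c g) = cnj c * ip f g"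
  using assms ip_cnj[of "fun_scale c g" f] ip_cnj[of g f] by (simp add: ip_scale)

definition hnorm :: "('a \<Rightarrow> complex) \<Rightarrow> real" where
  "hnorm f = sqrt (Re (ip f f))"

lemma ip_self_nonneg: "f \<in> H \<Longrightarrow> 0 \<le> Re (ip f f)"
  using ip_pos[of f] by (cases "f = 0") auto

lemma hnorm_nonneg [simp]: "f \<in> H \<Longrightarrow> 0 \<le> hnorm f"
  by (simp add: hnorm_def ip_self_nonneg)

lemma ip_self:
  assumes "f \<in> H"
  shows "ip f f = of_real ((hnorm f)\<^sup>2)"
proof -
  have "Im (ip f f) = 0"
    using arg_cong[OF ip_cnj[OF assms assms], of Im] by simp
  then show ?thesis
    using ip_self_nonneg[OF assms] by (simp add: hnorm_def complex_eq_iff)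
qed

lemma hnorm_eq_0 [simp]: "f \<in> H \<Longrightarrow> hnorm f = 0 \<longleftrightarrow> f = 0"
  using ip_pos[of f] by (cases "f = 0") (simp_all add: hnorm_def)

lemma hnorm_zero [simp]: "hnorm 0 = 0"
  by simp

lemma hnorm_pos: "f \<in> H \<Longrightarrow> f \<noteq> 0 \<Longrightarrow> 0 < hnorm f"
  using hnorm_nonneg[of f] hnorm_eq_0[of f] by linarith

lemma hnorm_scale:
  assumes "f \<in> H"
  shows "hnorm (fun_scale c f) = cmod c * hnorm f"
proof -
  have "cnj c * c = of_real ((cmod c)\<^sup>2)"
    using complex_norm_square[of c] by (simp add: mult.commute)
  then have "ip (fun_scale c f) (fun_scale c f) = of_real ((cmod c * hnorm f)\<^sup>2)"
    using assms by (simp add: ip_scale ip_scale_right ip_self[OF assms] power_mult_distrib)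
  then show ?thesis
    using assms by (simp add: hnorm_def[of "fun_scale c f"])
qed

text \<open>
  As usual, from positivity of the part of \<open>f\<close> orthogonal to \<open>g\<close>; that part is multiplied by
  \<open>\<parallel>g\<parallel>\<^sup>2\<close> (the vector \<open>k\<close> of the proof) to avoid division.
\<close>

lemma Cauchy_Schwarz:
  assumes f: "f \<in> H" and g: "g \<in> H"
  shows "cmod (ip f g) \<le> hnorm f * hnorm g"
proof (cases "g = 0")
  case False
  define a where "a = ip f g"
  define G where "G = (hnorm g)\<^sup>2"
  define k where "k = fun_scale (of_real G) f - fun_scale a g"
  have G: "G > 0" using hnorm_pos[OF g False] by (simp add: G_def)
  have ca: "ip g f = cnj a" using ip_cnj[OF f g] by (simp add: a_def)
  have "ip k k = of_real G * of_real G * of_real ((hnorm f)\<^sup>2) - of_real G * (a * cnj a)"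
    using f g
    by (simp add: k_def ip_diff ip_diff_right ip_scale ip_scale_right ip_self[of f]
        ip_self[of g] ca flip: a_def G_def) (simp add: algebra_simps)
  also have "\<dots> = of_real (G * (G * (hnorm f)\<^sup>2 - (cmod a)\<^sup>2))"
    by (simp add: complex_norm_square[symmetric] algebra_simps del: of_real_power
        flip: of_real_mult of_real_diff)
  finally have "Re (ip k k) = G * (G * (hnorm f)\<^sup>2 - (cmod a)\<^sup>2)" by simp
  moreover have "0 \<le> Re (ip k k)" using f g by (intro ip_self_nonneg) (simp add: k_def)
  ultimately have "(cmod a)\<^sup>2 \<le> G * (hnorm f)\<^sup>2"
    using G by (simp add: zero_le_mult_iff)
  then have "(cmod a)\<^sup>2 \<le> (hnorm f * hnorm g)\<^sup>2"
    by (simp add: G_def power_mult_distrib mult.commute)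
  then show ?thesis
    unfolding a_def using f g by (rule_tac power2_le_imp_le) auto
qed (use f in simp)

lemma hnorm_triangle:
  assumes f: "f \<in> H" and g: "g \<in> H"
  shows "hnorm (f + g) \<le> hnorm f + hnorm g"
proof (rule power2_le_imp_le)
  have "(hnorm (f + g))\<^sup>2 = Re (ip (f + g) (f + g))"
    using f g by (simp add: ip_self)
  also have "\<dots> = (hnorm f)\<^sup>2 + (hnorm g)\<^sup>2 + Re (ip f g) + Re (ip g f)"
    using f g by (simp add: ip_add ip_add_right ip_self[OF f] ip_self[OF g])
  also have "\<dots> \<le> (hnorm f)\<^sup>2 + (hnorm g)\<^sup>2 + hnorm f * hnorm g + hnorm g * hnorm f"
    using order_trans[OF complex_Re_le_cmod Cauchy_Schwarz[OF f g]]
      order_trans[OF complex_Re_le_cmod Cauchy_Schwarz[OF g f]] by linarith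
  also have "\<dots> = (hnorm f + hnorm g)\<^sup>2" by (simp add: power2_sum)
  finally show "(hnorm (f + g))\<^sup>2 \<le> (hnorm f + hnorm g)\<^sup>2" .
qed (use f g in simp)

lemma hnorm_minus_commute: "f \<in> H \<Longrightarrow> g \<in> H \<Longrightarrow> hnorm (f - g) = hnorm (g - f)"
  by (simp add: hnorm_def ip_diff ip_diff_right)

lemma hnorm_diff_le:
  assumes "f \<in> H" "g \<in> H"
  shows "hnorm (f - g) \<le> hnorm f + hnorm g"
proof -
  have "f - g = f + fun_scale (-1) g" by (simp add: fun_scale_def fun_eq_iff)
  then have "hnorm (f - g) \<le> hnorm f + hnorm (fun_scale (-1) g)"
    using hnorm_triangle[OF assms(1) scale_in[OF assms(2)]] by metis
  then show ?thesis unfolding hnorm_scale[OF assms(2)] by simp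
qed

lemma hfs_dist_eq: "f \<in> H \<Longrightarrow> g \<in> H \<Longrightarrow> hfs_dist H ip f g = hnorm (f - g)"
  by (simp add: hfs_dist_def hnorm_def)

sublocale met: Metric_space H "hfs_dist H ip"
proof
  show "0 \<le> hfs_dist H ip f g" for f g
    by (simp add: hfs_dist_def ip_self_nonneg)
  show "hfs_dist H ip f g = hfs_dist H ip g f" for f g
    using hnorm_minus_commute[of f g] by (auto simp: hfs_dist_def hnorm_def)
  show "hfs_dist H ip f g = 0 \<longleftrightarrow> f = g" if "f \<in> H" "g \<in> H" for f g
    using that by (simp add: hfs_dist_eq)
  show "hfs_dist H ip f h \<le> hfs_dist H ip f g + hfs_dist H ip g h"
    if "f \<in> H" "g \<in> H" "h \<in> H" for f g h
    using that hnorm_triangle[of "f - g" "g - h"] by (simp add: hfs_dist_eq)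
qed

lemma hfs_topology_eq: "hfs_topology H ip = met.mtopology"
  by (simp add: hfs_topology_def)

lemma limitin_iff_hnorm:
  assumes "\<And>n. \<sigma> n \<in> H"
  shows "limitin met.mtopology \<sigma> l sequentially
    \<longleftrightarrow> l \<in> H \<and> (\<lambda>n. hnorm (\<sigma> n - l)) \<longlonglongrightarrow> 0"
  using assms by (auto simp: met.limitin_metric_dist_null hfs_dist_eq)

lemma hnorm_Cauchy_converges:
  assumes "\<And>n. \<sigma> n \<in> H"
    and "\<And>\<epsilon>. \<epsilon> > 0 \<Longrightarrow> \<exists>N. \<forall>m\<ge>N. \<forall>n\<ge>N. hnorm (\<sigma> m - \<sigma> n) < \<epsilon>"
  obtains l where "limitin met.mtopology \<sigma> l sequentially"
proof -
  have "met.MCauchy \<sigma>"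
    unfolding met.MCauchy_def using assms by (auto simp: hfs_dist_eq)
  then show ?thesis
    using complete that unfolding met.mcomplete_def by blast
qed

section \<open>Finite codimension and compactness\<close>

text \<open>
  Since \<open>b\<close> has positive distance \<open>r\<close> from the closed subspace \<open>E\<close>, a vector \<open>h + \<beta> b\<close> has norm at
  least \<open>r |\<beta>|\<close>. So both components depend boundedly on the vector, and Cauchy sequences of such
  vectors have Cauchy components. Both facts serve to build \<open>H\<close> from \<open>E\<close> one vector at a time,
  without orthogonal projections.
\<close>

lemma closed_adjoin_vector:
  assumes clo: "closedin met.mtopology E" and sub: "cfun.subspace E"
    and b: "b \<in> H" "b \<notin> E"
  defines "E' \<equiv> {h + fun_scale \<beta> b | h \<beta>. h \<in> E}"
  obtains K where "K \<ge> 0"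
    "\<And>h \<beta>. h \<in> E \<Longrightarrow> cmod \<beta> \<le> K * hnorm (h + fun_scale \<beta> b)"
    "\<And>h \<beta>. h \<in> E \<Longrightarrow> hnorm h \<le> K * hnorm (h + fun_scale \<beta> b)"
    "closedin met.mtopology E'"
proof -
  have EH: "h \<in> H" if "h \<in> E" for h
    using clo that closedin_subset by fastforce
  obtain r where r: "r > 0" "disjnt E (met.mball b r)"
    using clo b unfolding met.closedin_metric by blast
  have far: "r \<le> hnorm (b - h)" if "h \<in> E" for h
    using r that b EH[OF that] by (force simp: disjnt_iff hfs_dist_eq)
  have coeff: "r * cmod \<beta> \<le> hnorm (h + fun_scale \<beta> b)" if h: "h \<in> E" for h \<beta>
  proof (cases "\<beta> = 0")
    case False
    \<comment> \<open>Dividing by \<open>\<beta>\<close> turns \<open>h + \<beta> b\<close> into the difference of \<open>b\<close> and an element of \<open>E\<close>.\<close>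
    define k where "k = fun_scale (- inverse \<beta>) h"
    have k: "k \<in> E" unfolding k_def using sub h by (rule cfun.subspace_scale)
    have "h + fun_scale \<beta> b = fun_scale \<beta> (b - k)"
      using False by (simp add: k_def fun_scale_def fun_eq_iff algebra_simps)
    then have "hnorm (h + fun_scale \<beta> b) = cmod \<beta> * hnorm (b - k)"
      using b EH[OF k] by (simp add: hnorm_scale)
    then show ?thesis
      using mult_left_mono[OF far[OF k], of "cmod \<beta>"] by (simp add: mult.commute)
  qed (use EH[OF h] b in simp)
  define K where "K = max (1 / r) (1 + hnorm b / r)"
  have K1: "cmod \<beta> \<le> K * hnorm (h + fun_scale \<beta> b)" if h: "h \<in> E" for h \<beta>
  proof -
    have "cmod \<beta> \<le> (1 / r) * hnorm (h + fun_scale \<beta> b)"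
      using coeff[OF h, of \<beta>] r by (simp add: field_simps)
    also have "\<dots> \<le> K * hnorm (h + fun_scale \<beta> b)"
      using EH[OF h] b by (intro mult_right_mono) (auto simp: K_def)
    finally show ?thesis .
  qed
  have K2: "hnorm h \<le> K * hnorm (h + fun_scale \<beta> b)" if h: "h \<in> E" for h \<beta>
  proof -
    let ?f = "h + fun_scale \<beta> b"
    have "hnorm h \<le> hnorm ?f + cmod \<beta> * hnorm b"
      using hnorm_diff_le[of ?f "fun_scale \<beta> b"] EH[OF h] b by (simp add: hnorm_scale)
    also have "\<dots> \<le> hnorm ?f + (hnorm ?f / r) * hnorm b"
      using coeff[OF h, of \<beta>] r b
      by (intro add_left_mono mult_right_mono) (auto simp: field_simps)
    also have "\<dots> = (1 + hnorm b / r) * hnorm ?f" by (simp add: algebra_simps)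
    also have "\<dots> \<le> K * hnorm ?f"
      using EH[OF h] b by (intro mult_right_mono) (auto simp: K_def)
    finally show ?thesis .
  qed
  have "closedin met.mtopology E'"
    unfolding met.metric_closedin_iff_sequentially_closed
  proof (intro conjI allI impI)
    show "E' \<subseteq> H" using EH b by (auto simp: E'_def)
    fix \<sigma> l assume *: "range \<sigma> \<subseteq> E' \<and> limitin met.mtopology \<sigma> l sequentially"
    have "\<forall>n. \<exists>h \<beta>. h \<in> E \<and> \<sigma> n = h + fun_scale \<beta> b"
      using * by (force simp: E'_def)
    then obtain h \<beta> where h: "\<And>n. h n \<in> E" and \<sigma>: "\<And>n. \<sigma> n = h n + fun_scale (\<beta> n) b"
      by metis
    have \<sigma>H: "\<sigma> n \<in> H" for n using \<sigma> EH[OF h] b by simp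
    have l: "l \<in> H" and lim: "(\<lambda>n. hnorm (\<sigma> n - l)) \<longlonglongrightarrow> 0"
      using * limitin_iff_hnorm[OF \<sigma>H] by auto
    have step: "r * cmod (\<beta> m - \<beta> n) \<le> hnorm (\<sigma> m - l) + hnorm (\<sigma> n - l)" for m n
    proof -
      have "\<sigma> m - \<sigma> n = (h m - h n) + fun_scale (\<beta> m - \<beta> n) b"
        by (simp add: \<sigma> fun_scale_def fun_eq_iff algebra_simps)
      moreover have "h m - h n \<in> E" using sub h by (simp add: cfun.subspace_diff)
      ultimately have "r * cmod (\<beta> m - \<beta> n) \<le> hnorm (\<sigma> m - \<sigma> n)"
        using coeff by metis
      also have "\<dots> \<le> hnorm (\<sigma> m - l) + hnorm (\<sigma> n - l)"
        using hnorm_diff_le[of "\<sigma> m - l" "\<sigma> n - l"] \<sigma>H l by simp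
      finally show ?thesis .
    qed
    have "Cauchy \<beta>"
      unfolding Cauchy_def
    proof (intro allI impI)
      fix e :: real assume "e > 0"
      then have "r * e / 2 > 0" using r by simp
      then obtain N where N: "\<And>n. n \<ge> N \<Longrightarrow> norm (hnorm (\<sigma> n - l)) < r * e / 2"
        using LIMSEQ_D[OF lim] by fastforce
      have "dist (\<beta> m) (\<beta> n) < e" if "m \<ge> N" "n \<ge> N" for m n
      proof -
        have "r * cmod (\<beta> m - \<beta> n) < r * e"
          using step[of m n] N[OF that(1)] N[OF that(2)] by simp
        then show ?thesis using r by (simp add: dist_norm)
      qed
      then show "\<exists>M. \<forall>m\<ge>M. \<forall>n\<ge>M. dist (\<beta> m) (\<beta> n) < e" by blast
    qed
    then obtain \<beta>0 where \<beta>0: "\<beta> \<longlonglongrightarrow> \<beta>0"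
      using Cauchy_convergent_iff convergent_def by metis
    define h0 where "h0 = l - fun_scale \<beta>0 b"
    have h0: "h0 \<in> H" using l b by (simp add: h0_def)
    have "limitin met.mtopology h h0 sequentially"
    proof -
      have "hnorm (h n - h0) \<le> hnorm (\<sigma> n - l) + cmod (\<beta> n - \<beta>0) * hnorm b" for n
      proof -
        have "h n - h0 = (\<sigma> n - l) - fun_scale (\<beta> n - \<beta>0) b"
          by (simp add: \<sigma> h0_def fun_scale_def fun_eq_iff algebra_simps)
        then show ?thesis
          using hnorm_diff_le[of "\<sigma> n - l" "fun_scale (\<beta> n - \<beta>0) b"] \<sigma>H l b
          by (simp add: hnorm_scale)
      qed
      moreover have "(\<lambda>n. hnorm (\<sigma> n - l) + cmod (\<beta> n - \<beta>0) * hnorm b) \<longlonglongrightarrow> 0 + 0 * hnorm b"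
        using \<beta>0 by (intro tendsto_intros lim) (simp add: LIM_zero tendsto_norm_zero)
      ultimately have "(\<lambda>n. hnorm (h n - h0)) \<longlonglongrightarrow> 0"
        using EH[OF h] h0
        by (intro tendsto_sandwich[of "\<lambda>_. 0" "\<lambda>n. hnorm (h n - h0)"]) auto
      then show ?thesis using limitin_iff_hnorm[of h h0] EH[OF h] h0 by simp
    qed
    then have "h0 \<in> E"
      using clo h unfolding met.metric_closedin_iff_sequentially_closed by blast
    moreover have "l = h0 + fun_scale \<beta>0 b" by (simp add: h0_def)
    ultimately show "l \<in> E'" by (auto simp: E'_def)
  qed
  moreover have "K \<ge> 0" using r by (auto simp: K_def le_max_iff_disj)
  ultimately show ?thesis using K1 K2 that by blast
qed

text \<open>
  This says that the restrictions to \<open>E\<close> of the functionals \<open>\<langle>\<cdot>, d\<^sub>n\<rangle>\<close> form a Cauchy sequence in the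
  dual norm. For \<open>E = H\<close> it means that \<open>d\<close> is a Cauchy sequence in norm.
\<close>

definition uniformly_weakly_Cauchy_on ::
    "('a \<Rightarrow> complex) set \<Rightarrow> (nat \<Rightarrow> 'a \<Rightarrow> complex) \<Rightarrow> bool" where
  "uniformly_weakly_Cauchy_on E d \<longleftrightarrow>
    (\<forall>\<epsilon>>0. \<exists>N. \<forall>m\<ge>N. \<forall>n\<ge>N. \<forall>h\<in>E. cmod (ip h (d m - d n)) \<le> \<epsilon> * hnorm h)"

lemma uniformly_weakly_Cauchy_on_subseq:
  assumes "uniformly_weakly_Cauchy_on E d" "strict_mono r"
  shows "uniformly_weakly_Cauchy_on E (d \<circ> r)"
  unfolding uniformly_weakly_Cauchy_on_def
proof (intro allI impI)
  fix \<epsilon> :: real assume "\<epsilon> > 0"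
  then obtain N where "\<forall>m\<ge>N. \<forall>n\<ge>N. \<forall>h\<in>E. cmod (ip h (d m - d n)) \<le> \<epsilon> * hnorm h"
    using assms(1) unfolding uniformly_weakly_Cauchy_on_def by blast
  then show "\<exists>N. \<forall>m\<ge>N. \<forall>n\<ge>N. \<forall>h\<in>E. cmod (ip h ((d \<circ> r) m - (d \<circ> r) n)) \<le> \<epsilon> * hnorm h"
    using seq_suble[OF assms(2)] by (metis comp_apply order_trans)
qed

text \<open>
  Induction on the finitely many vectors that span \<open>H\<close> together with \<open>E\<close>. Passing to a subsequence
  along which \<open>\<langle>b, d\<^sub>n\<rangle>\<close> converges makes the sequence uniformly weakly Cauchy on \<open>E + \<complex> b\<close>, because
  the components of a vector there are bounded by its norm. Once \<open>E\<close> is all of \<open>H\<close>, testing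
  \<open>d\<^sub>m - d\<^sub>n\<close> against itself shows that the sequence is Cauchy in norm.
\<close>

lemma finite_codim_convergent_subsequence:
  assumes "finite B" "closedin met.mtopology E" "cfun.subspace E" "B \<subseteq> H"
    "cfun.span (E \<union> B) = H"
    "\<And>n. d n \<in> H" "\<And>n. hnorm (d n) \<le> C" "uniformly_weakly_Cauchy_on E d"
  shows "\<exists>r l. strict_mono r \<and> limitin met.mtopology (d \<circ> r) l sequentially"
  using assms
proof (induction B arbitrary: E d rule: finite_induct)
  case empty
  have EH: "E = H"
    using empty.prems(2,4) by (metis sup_bot_right cfun.span_eq_iff)
  have "\<exists>N. \<forall>m\<ge>N. \<forall>n\<ge>N. hnorm (d m - d n) < \<epsilon>" if "\<epsilon> > 0" for \<epsilon>
  proof -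
    have "\<epsilon> / 2 > 0" using that by simp
    then obtain N where
      N: "\<forall>m\<ge>N. \<forall>n\<ge>N. \<forall>h\<in>H. cmod (ip h (d m - d n)) \<le> \<epsilon> / 2 * hnorm h"
      using empty.prems(7) EH unfolding uniformly_weakly_Cauchy_on_def by blast
    have "hnorm (d m - d n) < \<epsilon>" if "m \<ge> N" "n \<ge> N" for m n
    proof -
      let ?f = "d m - d n"
      have f: "?f \<in> H" using empty.prems(5) by simp
      have "(hnorm ?f)\<^sup>2 = cmod (ip ?f ?f)"
        using f by (simp add: ip_self norm_power)
      also have "\<dots> \<le> \<epsilon> / 2 * hnorm ?f" using N that f by blast
      finally have "hnorm ?f * hnorm ?f \<le> \<epsilon> / 2 * hnorm ?f" by (simp add: power2_eq_square)
      then have "hnorm ?f \<le> \<epsilon> / 2 \<or> hnorm ?f = 0"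
        using hnorm_nonneg[OF f] by (auto simp: mult_le_cancel_right)
      then show ?thesis using \<open>\<epsilon> > 0\<close> by auto
    qed
    then show ?thesis by blast
  qed
  then obtain l where "limitin met.mtopology d l sequentially"
    using hnorm_Cauchy_converges empty.prems(5) by blast
  then show ?case
    by (intro exI[of _ id] exI[of _ l]) (auto simp: strict_mono_def)
next
  case (insert b B)
  note clo = insert.prems(1) and sub = insert.prems(2) and dH = insert.prems(5)
    and dC = insert.prems(6) and unif = insert.prems(7)
  have b: "b \<in> H" and B: "B \<subseteq> H" using insert.prems(3) by auto
  have EH: "h \<in> H" if "h \<in> E" for h
    using clo that closedin_subset by fastforce
  show ?case
  proof (cases "b \<in> E")
    case True
    then have "E \<union> B = E \<union> insert b B" by blast
    then have "cfun.span (E \<union> B) = H" using insert.prems(4) by simp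
    then show ?thesis
      using insert.IH[OF clo sub B _ dH dC unif] by simp
  next
    case False
    define E' where "E' = {h + fun_scale \<beta> b | h \<beta>. h \<in> E}"
    obtain K where K: "K \<ge> 0"
      "\<And>h \<beta>. h \<in> E \<Longrightarrow> cmod \<beta> \<le> K * hnorm (h + fun_scale \<beta> b)"
      "\<And>h \<beta>. h \<in> E \<Longrightarrow> hnorm h \<le> K * hnorm (h + fun_scale \<beta> b)"
      "closedin met.mtopology E'"
      using closed_adjoin_vector[OF clo sub b False] unfolding E'_def by blast
    have E'_span: "E' = cfun.span (insert b E)"
    proof -
      have "E' = {x. \<exists>k. x - fun_scale k b \<in> E}"
      proof (intro set_eqI iffI)
        show "x \<in> {x. \<exists>k. x - fun_scale k b \<in> E}" if "x \<in> E'" for x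
        proof -
          obtain h \<beta> where "h \<in> E" "x = h + fun_scale \<beta> b"
            using \<open>x \<in> E'\<close> unfolding E'_def by blast
          then have "x - fun_scale \<beta> b \<in> E" by simp
          then show ?thesis by blast
        qed
        show "x \<in> E'" if x: "x \<in> {x. \<exists>k. x - fun_scale k b \<in> E}" for x
        proof -
          obtain k where "x - fun_scale k b \<in> E" using x by blast
          moreover have "x = (x - fun_scale k b) + fun_scale k b" by simp
          ultimately show ?thesis unfolding E'_def by blast
        qed
      qed
      then show ?thesis
        by (simp add: cfun.span_insert cfun.span_eq_iff[THEN iffD2, OF sub])
    qed
    have sub': "cfun.subspace E'" by (simp add: E'_span)
    have span': "cfun.span (E' \<union> B) = H"
    proof
      have "E' \<subseteq> H" using K(4) closedin_subset by fastforce
      then show "cfun.span (E' \<union> B) \<subseteq> H"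
        using B subspace by (intro cfun.span_minimal) auto
      have "E \<union> insert b B \<subseteq> E' \<union> B"
        unfolding E'_span using cfun.span_superset[of "insert b E"] by blast
      then show "H \<subseteq> cfun.span (E' \<union> B)"
        using cfun.span_mono insert.prems(4) by metis
    qed
    have "bounded (range (\<lambda>n. ip b (d n)))"
      unfolding bounded_iff
    proof (intro exI ballI)
      fix z assume "z \<in> range (\<lambda>n. ip b (d n))"
      then obtain n where "z = ip b (d n)" by auto
      moreover have "hnorm b * hnorm (d n) \<le> hnorm b * C"
        using dC b by (simp add: mult_left_mono)
      ultimately show "norm z \<le> hnorm b * C"
        using Cauchy_Schwarz[OF b dH, of n] by simp
    qed
    then obtain z s where s: "strict_mono s" "((\<lambda>n. ip b (d n)) \<circ> s) \<longlonglongrightarrow> z"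
      using bounded_imp_convergent_subsequence by blast
    have unifs: "uniformly_weakly_Cauchy_on E (d \<circ> s)"
      using unif s(1) by (rule uniformly_weakly_Cauchy_on_subseq)
    have "uniformly_weakly_Cauchy_on E' (d \<circ> s)"
      unfolding uniformly_weakly_Cauchy_on_def
    proof (intro allI impI)
      fix \<epsilon> :: real assume \<epsilon>: "\<epsilon> > 0"
      \<comment> \<open>Each of the two components of \<open>f\<close> contributes at most \<open>\<eta> K \<parallel>f\<parallel>\<close>.\<close>
      define \<eta> where "\<eta> = \<epsilon> / (2 * (K + 1))"
      have \<eta>: "\<eta> > 0" and \<eta>K: "2 * (\<eta> * K) \<le> \<epsilon>"
        using \<epsilon> K(1) by (auto simp: \<eta>_def field_simps)
      obtain N1 where N1: "\<And>m n h. m \<ge> N1 \<Longrightarrow> n \<ge> N1 \<Longrightarrow> h \<in> E \<Longrightarrow>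
          cmod (ip h ((d \<circ> s) m - (d \<circ> s) n)) \<le> \<eta> * hnorm h"
        using unifs \<eta> unfolding uniformly_weakly_Cauchy_on_def by blast
      obtain N2 where N2: "\<And>m n. m \<ge> N2 \<Longrightarrow> n \<ge> N2 \<Longrightarrow> cmod (ip b (d (s m)) - ip b (d (s n))) < \<eta>"
        using LIMSEQ_imp_Cauchy[OF s(2)] \<eta> unfolding Cauchy_def dist_norm comp_def by metis
      have "cmod (ip f ((d \<circ> s) m - (d \<circ> s) n)) \<le> \<epsilon> * hnorm f"
        if mn: "m \<ge> max N1 N2" "n \<ge> max N1 N2" and f: "f \<in> E'" for m n f
      proof -
        obtain h \<beta> where h: "h \<in> E" and fh: "f = h + fun_scale \<beta> b"
          using f by (auto simp: E'_def)
        have fH: "f \<in> H" using fh EH[OF h] b by simp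
        let ?k = "(d \<circ> s) m - (d \<circ> s) n"
        have "ip f ?k = ip h ?k + \<beta> * ip b ?k"
          using EH[OF h] b dH by (simp add: fh ip_add ip_scale)
        then have "cmod (ip f ?k) \<le> cmod (ip h ?k) + cmod \<beta> * cmod (ip b ?k)"
          by (metis norm_mult norm_triangle_ineq)
        also have "\<dots> \<le> \<eta> * hnorm h + cmod \<beta> * \<eta>"
          using N1[OF _ _ h, of m n] N2[of m n] mn b dH
          by (intro add_mono mult_left_mono) (auto simp: ip_diff_right)
        also have "\<dots> \<le> \<eta> * (K * hnorm f) + (K * hnorm f) * \<eta>"
          using K(2,3)[OF h, of \<beta>] \<eta> by (intro add_mono mult_left_mono mult_right_mono) (auto simp: fh)
        also have "\<dots> = 2 * (\<eta> * K) * hnorm f" by simp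
        also have "\<dots> \<le> \<epsilon> * hnorm f" using \<eta>K fH by (intro mult_right_mono) auto
        finally show ?thesis .
      qed
      then show "\<exists>N. \<forall>m\<ge>N. \<forall>n\<ge>N. \<forall>h\<in>E'. cmod (ip h ((d \<circ> s) m - (d \<circ> s) n)) \<le> \<epsilon> * hnorm h"
        by blast
    qed
    then have "\<exists>r l. strict_mono r \<and> limitin met.mtopology ((d \<circ> s) \<circ> r) l sequentially"
      using dH dC by (intro insert.IH[OF K(4) sub' B span']) (auto simp: comp_def)
    then obtain r l where "strict_mono r" "limitin met.mtopology ((d \<circ> s) \<circ> r) l sequentially"
      by blast
    then show ?thesis
      using s(1) by (metis strict_mono_o comp_assoc)
  qed
qed

text \<open>
  The uniform boundedness principle, for the functionals \<open>\<langle>\<cdot>, e\<^sub>n\<rangle>\<close> on the closed subspace \<open>E\<close>: the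
  closed sets \<open>A M\<close> on which all of them are bounded by \<open>M\<close> cover the complete space \<open>E\<close>, so by
  Baire one of them contains a ball, and a bound on a ball gives a bound on the operator norms.
\<close>

lemma uniform_boundedness:
  assumes clo: "closedin met.mtopology E" and sub: "cfun.subspace E"
    and eH: "\<And>n::nat. e n \<in> H"
    and bdd: "\<And>h. h \<in> E \<Longrightarrow> \<exists>M. \<forall>n. cmod (ip h (e n)) \<le> M"
  obtains K where "K \<ge> 0" "\<And>h n. h \<in> E \<Longrightarrow> cmod (ip h (e n)) \<le> K * hnorm h"
proof -
  have EH: "E \<subseteq> H" using clo closedin_subset by fastforce
  interpret S: Submetric H "hfs_dist H ip" E
    by unfold_locales (fact EH)
  define A where "A M = {h \<in> E. \<forall>n. cmod (ip h (e n)) \<le> real M}" for M :: nat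
  have cloA: "closedin S.sub.mtopology (A M)" for M
    unfolding S.sub.metric_closedin_iff_sequentially_closed
  proof (intro conjI allI impI)
    show "A M \<subseteq> E" by (auto simp: A_def)
    fix \<sigma> l assume *: "range \<sigma> \<subseteq> A M \<and> limitin S.sub.mtopology \<sigma> l sequentially"
    have \<sigma>: "\<sigma> k \<in> A M" for k using * by auto
    have \<sigma>E: "\<sigma> k \<in> E" for k using \<sigma> by (auto simp: A_def)
    have \<sigma>H: "\<sigma> k \<in> H" for k using \<sigma>E EH by auto
    have l: "l \<in> E" and "limitin met.mtopology \<sigma> l sequentially"
      using * by (auto simp: S.limitin_submetric_iff)
    then have lim: "(\<lambda>k. hnorm (\<sigma> k - l)) \<longlonglongrightarrow> 0" and lH: "l \<in> H"
      using limitin_iff_hnorm[OF \<sigma>H] by auto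
    have "cmod (ip l (e n)) \<le> real M" for n
    proof -
      have "(\<lambda>k. real M + hnorm (\<sigma> k - l) * hnorm (e n)) \<longlonglongrightarrow> real M + 0 * hnorm (e n)"
        by (intro tendsto_intros lim)
      moreover have "cmod (ip l (e n)) \<le> real M + hnorm (\<sigma> k - l) * hnorm (e n)" for k
      proof -
        have "ip l (e n) = ip (\<sigma> k) (e n) - ip (\<sigma> k - l) (e n)"
          using lH \<sigma>H eH by (simp add: ip_diff)
        then have "cmod (ip l (e n)) \<le> cmod (ip (\<sigma> k) (e n)) + cmod (ip (\<sigma> k - l) (e n))"
          by (simp add: norm_triangle_ineq4)
        moreover have "cmod (ip (\<sigma> k) (e n)) \<le> real M" using \<sigma> by (auto simp: A_def)
        moreover have "cmod (ip (\<sigma> k - l) (e n)) \<le> hnorm (\<sigma> k - l) * hnorm (e n)"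
          using lH \<sigma>H eH by (intro Cauchy_Schwarz) auto
        ultimately show ?thesis by linarith
      qed
      ultimately show ?thesis
        using LIMSEQ_le_const[of _ "real M"] by fastforce
    qed
    then show "l \<in> A M" using l by (simp add: A_def)
  qed
  have "\<Union> (range A) = E"
  proof
    show "E \<subseteq> \<Union> (range A)"
    proof
      fix h assume h: "h \<in> E"
      then obtain M where "\<forall>n. cmod (ip h (e n)) \<le> M" using bdd by blast
      moreover obtain m where "M \<le> real m" using real_arch_simple by blast
      ultimately have "h \<in> A m"
        unfolding A_def using h by (blast intro: order_trans)
      then show "h \<in> \<Union> (range A)" by blast
    qed
  qed (auto simp: A_def)
  moreover have "0 \<in> E" using sub by (rule cfun.subspace_0)
  moreover have "S.sub.mtopology interior_of E = E"
    using interior_of_topspace[of S.sub.mtopology] by simp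
  ultimately have "S.sub.mtopology interior_of \<Union> (range A) \<noteq> {}" by auto
  moreover have "S.sub.mcomplete"
    using S.closedin_mcomplete_imp_mcomplete[OF clo complete] .
  ultimately obtain M where "S.sub.mtopology interior_of A M \<noteq> {}"
    using S.sub.metric_Baire_category_alt[of "range A"] cloA by auto
  then obtain h0 \<rho> where h0: "h0 \<in> E" and \<rho>: "\<rho> > 0" and ball: "S.sub.mball h0 \<rho> \<subseteq> A M"
    by (auto simp: S.sub.metric_interior_of)
  define K where "K = 4 * real M / \<rho>"
  have "cmod (ip h (e n)) \<le> K * hnorm h" if h: "h \<in> E" for h n
  proof (cases "h = 0")
    case False
    have hH: "h \<in> H" and h0H: "h0 \<in> H" using h h0 EH by auto
    have pos: "hnorm h > 0" using hH False by (rule hnorm_pos)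
    \<comment> \<open>Rescaled by \<open>t\<close>, the vector \<open>h\<close> has norm \<open>\<rho> / 2\<close>, so that \<open>h0 + t h\<close> stays inside the ball.\<close>
    define t where "t = \<rho> / (2 * hnorm h)"
    have t: "t > 0" using pos \<rho> by (simp add: t_def)
    let ?x = "h0 + fun_scale (of_real t) h"
    have xE: "?x \<in> E" using sub h h0 by (simp add: cfun.subspace_add cfun.subspace_scale)
    have "hfs_dist H ip h0 ?x = hnorm (fun_scale (of_real t) h)"
      using hH h0H hnorm_minus_commute[of h0 ?x] by (simp add: hfs_dist_eq)
    also have "\<dots> = \<rho> / 2" using hH t False by (simp add: hnorm_scale) (simp add: t_def)
    finally have "?x \<in> A M" using ball xE h0 \<rho> by auto
    moreover have "h0 \<in> A M" using ball h0 \<rho> by auto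
    ultimately have "cmod (ip ?x (e n)) \<le> real M" "cmod (ip h0 (e n)) \<le> real M"
      by (auto simp: A_def)
    moreover have "of_real t * ip h (e n) = ip ?x (e n) - ip h0 (e n)"
      using hH h0H eH by (simp add: ip_add ip_scale)
    then have "t * cmod (ip h (e n)) \<le> cmod (ip ?x (e n)) + cmod (ip h0 (e n))"
      using t by (metis norm_mult norm_of_real norm_triangle_ineq4 abs_of_pos)
    ultimately have "t * cmod (ip h (e n)) \<le> 2 * real M" by linarith
    then show ?thesis
      using pos \<rho> by (simp add: K_def t_def field_simps)
  qed (use eH in simp)
  moreover have "K \<ge> 0" using \<rho> by (simp add: K_def)
  ultimately show ?thesis using that by blast
qed

section \<open>Vectors seen by a pseudomultiplier\<close>

text \<open>
  The map \<open>f \<mapsto> f\<^sub>v\<close> is an isometric linear isomorphism of \<open>H\<close> onto the extended space, so metric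
  structure, closed sets and finite codimension carry over.
\<close>

lemma ext_fun_comp_Some [simp]: "ext_fun ip v f \<circ> Some = f"
  by (simp add: ext_fun_def fun_eq_iff)

lemma ext_fun_add:
  "v \<in> H \<Longrightarrow> f \<in> H \<Longrightarrow> g \<in> H \<Longrightarrow> ext_fun ip v (f + g) = ext_fun ip v f + ext_fun ip v g"
  by (auto simp: ext_fun_def fun_eq_iff ip_add split: option.split)

lemma ext_fun_diff:
  "v \<in> H \<Longrightarrow> f \<in> H \<Longrightarrow> g \<in> H \<Longrightarrow> ext_fun ip v (f - g) = ext_fun ip v f - ext_fun ip v g"
  by (auto simp: ext_fun_def fun_eq_iff ip_diff split: option.split)

lemma ext_fun_scale:
  "v \<in> H \<Longrightarrow> f \<in> H \<Longrightarrow> ext_fun ip v (fun_scale k f) = fun_scale k (ext_fun ip v f)"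
  by (auto simp: ext_fun_def fun_scale_def fun_eq_iff split: option.split
      dest: ip_scale[of _ _ k, unfolded fun_scale_def])

lemma ext_fun_zero: "v \<in> H \<Longrightarrow> ext_fun ip v 0 = 0"
  by (auto simp: ext_fun_def fun_eq_iff split: option.split)

lemma ext_fun_eq_iff [simp]: "ext_fun ip v f = ext_fun ip v g \<longleftrightarrow> f = g"
  by (metis ext_fun_comp_Some)

lemma hfs_dist_ext:
  assumes "v \<in> H" "f \<in> H" "g \<in> H"
  shows "hfs_dist (ext_space H ip v) (ext_ip ip) (ext_fun ip v f) (ext_fun ip v g)
    = hfs_dist H ip f g"
  using assms
  by (simp add: hfs_dist_def ext_space_def ext_ip_def ext_fun_diff[symmetric])

lemma Metric_space_ext:
  assumes v: "v \<in> H"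
  shows "Metric_space (ext_space H ip v) (hfs_dist (ext_space H ip v) (ext_ip ip))"
proof
  let ?d = "hfs_dist (ext_space H ip v) (ext_ip ip)"
  \<comment> \<open>The distance is zero by definition unless both arguments lie in the space.\<close>
  have cases: "(\<exists>f\<in>H. \<exists>g\<in>H. F = ext_fun ip v f \<and> G = ext_fun ip v g) \<or> (?d F G = 0 \<and> ?d G F = 0)"
    for F G
    by (auto simp: hfs_dist_def ext_space_def)
  show "0 \<le> ?d F G" for F G
    using cases[of F G] by (auto simp: hfs_dist_ext[OF v])
  show "?d F G = ?d G F" for F G
    using cases[of F G] by (auto simp: hfs_dist_ext[OF v] met.commute)
  show "?d F G = 0 \<longleftrightarrow> F = G" if "F \<in> ext_space H ip v" "G \<in> ext_space H ip v" for F G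
    using that by (auto simp: ext_space_def hfs_dist_ext[OF v, unfolded ext_space_def])
  show "?d F K \<le> ?d F G + ?d G K"
    if "F \<in> ext_space H ip v" "G \<in> ext_space H ip v" "K \<in> ext_space H ip v" for F G K
    using that by (auto simp: ext_space_def hfs_dist_ext[OF v, unfolded ext_space_def] met.triangle)
qed

lemma closedin_ext:
  assumes v: "v \<in> H" and clo: "closedin (hfs_topology H ip) E"
  shows "closedin (hfs_topology (ext_space H ip v) (ext_ip ip)) (ext_fun ip v ` E)"
proof -
  interpret X: Metric_space "ext_space H ip v" "hfs_dist (ext_space H ip v) (ext_ip ip)"
    using v by (rule Metric_space_ext)
  have E: "E \<subseteq> H" and far: "\<And>f. f \<in> H - E \<Longrightarrow> \<exists>r>0. disjnt E (met.mball f r)"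
    using clo unfolding hfs_topology_eq met.closedin_metric by auto
  have "\<exists>r>0. disjnt (ext_fun ip v ` E) (X.mball F r)"
    if F: "F \<in> ext_space H ip v - ext_fun ip v ` E" for F
  proof -
    obtain f where f: "f \<in> H - E" "F = ext_fun ip v f"
      using F by (auto simp: ext_space_def)
    obtain r where "r > 0" and r: "disjnt E (met.mball f r)" using far[OF f(1)] by blast
    have "disjnt (ext_fun ip v ` E) (X.mball F r)"
      using r f E v by (force simp: disjnt_iff hfs_dist_ext)
    then show ?thesis using \<open>r > 0\<close> by blast
  qed
  then show ?thesis
    unfolding hfs_topology_def X.closedin_metric using E by (auto simp: ext_space_def)
qed

lemma finite_codim_ext:
  assumes v: "v \<in> H" and E: "E \<subseteq> H" and fin: "finite_codim H E"
  shows "finite_codim (ext_space H ip v) (ext_fun ip v ` E)"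
proof -
  obtain B where B: "finite B" "B \<subseteq> H" "cfun.span (E \<union> B) = H"
    using fin unfolding finite_codim_def by blast
  let ?x = "ext_fun ip v"
  let ?S = "cfun.span (?x ` E \<union> ?x ` B)"
  have subX: "cfun.subspace (?x ` H)"
  proof (rule cfun.subspaceI)
    show "0 \<in> ?x ` H" using ext_fun_zero[OF v] zero_in by (metis image_eqI)
    show "F + G \<in> ?x ` H" if "F \<in> ?x ` H" "G \<in> ?x ` H" for F G
      using that by (auto simp: ext_fun_add[OF v, symmetric])
    show "fun_scale k F \<in> ?x ` H" if "F \<in> ?x ` H" for k F
      using that by (auto simp: ext_fun_scale[OF v, symmetric])
  qed
  have "?S \<subseteq> ?x ` H"
    using subX B(2) E by (intro cfun.span_minimal) auto
  moreover have "cfun.span (E \<union> B) \<subseteq> {f \<in> H. ?x f \<in> ?S}"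
  proof (rule cfun.span_minimal)
    show "E \<union> B \<subseteq> {f \<in> H. ?x f \<in> ?S}" using B(2) E by (auto intro: cfun.span_base)
    show "cfun.subspace {f \<in> H. ?x f \<in> ?S}"
      by (rule cfun.subspaceI)
        (auto simp: ext_fun_zero ext_fun_add ext_fun_scale v cfun.span_zero cfun.span_add
          cfun.span_scale)
  qed
  ultimately have "?S = ?x ` H" using B(3) by blast
  then show ?thesis
    unfolding finite_codim_def ext_space_def using B(1,2) by (intro exI[of _ "?x ` B"]) auto
qed

text \<open>
  Since \<^term>\<open>dom \<phi>\<close> is a set of uniqueness, \<open>h\<close> determines the product \<open>g\<close> of \<open>\<phi>\<close> and \<open>h\<close>. If an
  extension \<open>\<psi>\<close> does not shrink \<open>E\<close>, then \<open>\<psi> h\<^sub>v\<close> agrees with \<open>g\<^sub>v\<close>, and evaluating at the new point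
  gives the linear condition. Conversely, this equation is just what lets the extension of \<open>\<phi>\<close>
  by the single value \<open>c\<close> at the new point keep every element of \<open>E\<close>.
\<close>

lemma sees_with_value_iff:
  assumes pm: "pseudomultiplier \<Omega> H ip \<phi>" and v: "v \<in> H"
  shows "sees_with_value \<Omega> H ip \<phi> v c \<longleftrightarrow>
    (\<forall>h\<in>H. \<forall>g\<in>H. (\<forall>x\<in>dom \<phi>. g x = the (\<phi> x) * h x) \<longrightarrow> ip g v = c * ip h v)"
    (is "_ \<longleftrightarrow> ?eigen")
proof
  assume "sees_with_value \<Omega> H ip \<phi> v c"
  then obtain \<psi> where dom: "Some ` dom \<phi> \<subseteq> dom \<psi>" and ext: "\<And>x. x \<in> dom \<phi> \<Longrightarrow> \<psi> (Some x) = \<phi> x"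
    and E: "pm_E H \<phi> = (\<lambda>F. F \<circ> Some) ` pm_E (ext_space H ip v) \<psi>" and None: "\<psi> None = Some c"
    unfolding sees_with_value_def
    by (elim conjE exE) (rule that, assumption, erule (1) bspec, assumption+)
  show ?eigen
  proof (intro ballI impI)
    fix h g assume h: "h \<in> H" and g: "g \<in> H" and gh: "\<forall>x\<in>dom \<phi>. g x = the (\<phi> x) * h x"
    then have "h \<in> pm_E H \<phi>" by (auto simp: pm_E_def)
    then obtain F where F: "F \<in> pm_E (ext_space H ip v) \<psi>" "h = F \<circ> Some" using E by auto
    have "F \<in> ext_space H ip v" using F(1) unfolding pm_E_def by blast
    then have Fh: "F = ext_fun ip v h" using F(2) by (auto simp: ext_space_def)
    obtain g' where g': "g' \<in> H" "\<And>y. y \<in> dom \<psi> \<Longrightarrow> ext_fun ip v g' y = the (\<psi> y) * F y"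
      using F(1) unfolding pm_E_def ext_space_def by blast
    have "g' x = g x" if x: "x \<in> dom \<phi>" for x
    proof -
      have "Some x \<in> dom \<psi>" using dom x by blast
      then have "ext_fun ip v g' (Some x) = the (\<psi> (Some x)) * F (Some x)" by (rule g'(2))
      then show ?thesis using bspec[OF gh x] by (simp add: ext[OF x] Fh ext_fun_def)
    qed
    then have "g' = g"
      using pm g g'(1) unfolding pseudomultiplier_def set_of_uniqueness_def by blast
    moreover have "None \<in> dom \<psi>" using None by auto
    then have "ext_fun ip v g' None = c * F None" using g'(2)[of None] None by simp
    ultimately show "ip g v = c * ip h v" by (simp add: Fh ext_fun_def)
  qed
next
  assume eigen: ?eigen
  define \<psi> where "\<psi> = case_option (Some c) \<phi>"
  have dom\<psi>: "dom \<psi> = insert None (Some ` dom \<phi>)"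
  proof (rule set_eqI)
    show "y \<in> dom \<psi> \<longleftrightarrow> y \<in> insert None (Some ` dom \<phi>)" for y
      by (cases y) (auto simp: \<psi>_def)
  qed
  have E: "pm_E (ext_space H ip v) \<psi> = ext_fun ip v ` pm_E H \<phi>"
  proof (intro set_eqI iffI)
    fix F assume "F \<in> pm_E (ext_space H ip v) \<psi>"
    then obtain h g where h: "F = ext_fun ip v h" "h \<in> H" and g: "g \<in> H"
      "\<forall>y\<in>dom \<psi>. ext_fun ip v g y = the (\<psi> y) * F y"
      by (auto simp: pm_E_def ext_space_def)
    have "g x = the (\<phi> x) * h x" if "x \<in> dom \<phi>" for x
    proof -
      have "Some x \<in> dom \<psi>" using that by (simp add: dom\<psi>)
      from bspec[OF g(2) this] show ?thesis by (simp add: h(1) \<psi>_def ext_fun_def)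
    qed
    then show "F \<in> ext_fun ip v ` pm_E H \<phi>"
      using h g(1) by (auto simp: pm_E_def)
  next
    fix F assume "F \<in> ext_fun ip v ` pm_E H \<phi>"
    then obtain h g where h: "F = ext_fun ip v h" "h \<in> H" and g: "g \<in> H"
      "\<forall>x\<in>dom \<phi>. g x = the (\<phi> x) * h x"
      by (auto simp: pm_E_def)
    then have "ip g v = c * ip h v" using eigen by blast
    then have "\<forall>y\<in>dom \<psi>. ext_fun ip v g y = the (\<psi> y) * F y"
      using g(2) unfolding dom\<psi> by (simp add: \<psi>_def ext_fun_def h(1))
    then show "F \<in> pm_E (ext_space H ip v) \<psi>"
      using h g(1) by (auto simp: pm_E_def ext_space_def)
  qed
  have uniq: "set_of_uniqueness \<Omega> H (dom \<phi>)" and clo: "closedin (hfs_topology H ip) (pm_E H \<phi>)"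
    and fin: "finite_codim H (pm_E H \<phi>)"
    using pm unfolding pseudomultiplier_def by auto
  have EH: "pm_E H \<phi> \<subseteq> H" by (auto simp: pm_E_def)
  have "set_of_uniqueness (ext_points \<Omega>) (ext_space H ip v) (dom \<psi>)"
    unfolding set_of_uniqueness_def
  proof (intro conjI ballI impI)
    show "dom \<psi> \<subseteq> ext_points \<Omega>"
      using uniq by (auto simp: dom\<psi> ext_points_def set_of_uniqueness_def)
    fix F G assume F: "F \<in> ext_space H ip v" and G: "G \<in> ext_space H ip v"
      and FG: "\<forall>y\<in>dom \<psi>. F y = G y"
    obtain f g where fg: "f \<in> H" "g \<in> H" "F = ext_fun ip v f" "G = ext_fun ip v g"
      using F G by (auto simp: ext_space_def)
    have "f x = g x" if "x \<in> dom \<phi>" for x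
      using FG that fg by (force simp: dom\<psi> ext_fun_def)
    then have "f = g" using uniq fg unfolding set_of_uniqueness_def by blast
    then show "F = G" using fg by simp
  qed
  then have "pseudomultiplier (ext_points \<Omega>) (ext_space H ip v) (ext_ip ip) \<psi>"
    unfolding pseudomultiplier_def E
    using closedin_ext[OF v clo] finite_codim_ext[OF v EH fin] by blast
  moreover have "pm_E H \<phi> = (\<lambda>F. F \<circ> Some) ` pm_E (ext_space H ip v) \<psi>"
    by (simp add: E image_image)
  ultimately show "sees_with_value \<Omega> H ip \<phi> v c"
    unfolding sees_with_value_def using v dom\<psi> by (intro conjI exI[of _ \<psi>]) (auto simp: \<psi>_def)
qed

lemma sees_with_value_scale:
  assumes pm: "pseudomultiplier \<Omega> H ip \<phi>" and "sees_with_value \<Omega> H ip \<phi> v c"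
  shows "sees_with_value \<Omega> H ip \<phi> (fun_scale s v) c"
proof -
  have "v \<in> H" using assms(2) by (simp add: sees_with_value_def)
  then show ?thesis
    using assms(2) sees_with_value_iff[OF pm] by (simp add: ip_scale_right)
qed

text \<open>
  If \<open>d\<close> satisfied the linear condition for two values, it would be orthogonal to all \<open>h \<in> E\<close> and to
  all their products with \<open>\<phi>\<close>. Then the equation would hold for every value, so \<open>d\<close> would be ambiguous,
  and definability would make it orthogonal to itself.
\<close>

lemma vector_value_eqI:
  assumes pm: "pseudomultiplier \<Omega> H ip \<phi>" and d: "d \<in> definable_vectors \<Omega> H ip \<phi>"
    and c: "sees_with_value \<Omega> H ip \<phi> d c"
  shows "vector_value \<Omega> H ip \<phi> d = c"
  unfolding vector_value_def
proof (rule the_equality)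
  show "sees_with_value \<Omega> H ip \<phi> d c" by fact
  fix c' assume c': "sees_with_value \<Omega> H ip \<phi> d c'"
  have dH: "d \<in> H" and d0: "d \<noteq> 0" using d by (auto simp: definable_vectors_def)
  show "c' = c"
  proof (rule ccontr)
    assume ne: "c' \<noteq> c"
    have both: "ip h d = 0 \<and> ip g d = 0"
      if "h \<in> H" "g \<in> H" "\<forall>x\<in>dom \<phi>. g x = the (\<phi> x) * h x" for h g
    proof -
      have "ip g d = c * ip h d" "ip g d = c' * ip h d"
        using c c' that unfolding sees_with_value_iff[OF pm dH] by blast+
      then show ?thesis using ne by auto
    qed
    have "sees_with_value \<Omega> H ip \<phi> d k" for k
      unfolding sees_with_value_iff[OF pm dH] using both by (metis mult_zero_right)
    then have "d \<in> ambiguous_vectors \<Omega> H ip \<phi>"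
      unfolding ambiguous_vectors_def using dH by blast
    then have "ip d d = 0" using d by (auto simp: definable_vectors_def)
    then show False using ip_pos[OF dH d0] by simp
  qed
qed

lemma vector_value_sees:
  assumes pm: "pseudomultiplier \<Omega> H ip \<phi>" and d: "d \<in> definable_vectors \<Omega> H ip \<phi>"
  shows "sees_with_value \<Omega> H ip \<phi> d (vector_value \<Omega> H ip \<phi> d)"
  using d vector_value_eqI[OF pm d] by (auto simp: definable_vectors_def sees_def)

lemma definable_scale:
  assumes pm: "pseudomultiplier \<Omega> H ip \<phi>" and d: "d \<in> definable_vectors \<Omega> H ip \<phi>"
    and s: "s \<noteq> 0"
  shows "fun_scale s d \<in> definable_vectors \<Omega> H ip \<phi>"
    and "vector_value \<Omega> H ip \<phi> (fun_scale s d) = vector_value \<Omega> H ip \<phi> d"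
proof -
  have *: "sees_with_value \<Omega> H ip \<phi> (fun_scale s d) (vector_value \<Omega> H ip \<phi> d)"
    using pm vector_value_sees[OF pm d] by (rule sees_with_value_scale)
  have "fun_scale s d \<noteq> 0" "fun_scale s d \<in> H"
    using d s by (auto simp: definable_vectors_def)
  moreover have "ip (fun_scale s d) v = 0" if "v \<in> ambiguous_vectors \<Omega> H ip \<phi>" for v
    using d that by (auto simp: definable_vectors_def ambiguous_vectors_def ip_scale)
  ultimately show **: "fun_scale s d \<in> definable_vectors \<Omega> H ip \<phi>"
    using * by (auto simp: definable_vectors_def sees_def)
  show "vector_value \<Omega> H ip \<phi> (fun_scale s d) = vector_value \<Omega> H ip \<phi> d"
    using pm ** * by (rule vector_value_eqI)
qed

section \<open>Polar vectors\<close>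

lemma pm_E_subspace: "cfun.subspace (pm_E H \<phi>)"
proof (rule cfun.subspaceI)
  show "0 \<in> pm_E H \<phi>" by (auto simp: pm_E_def intro!: bexI[of _ 0])
  fix f f' k assume "f \<in> pm_E H \<phi>"
  then obtain g where g: "f \<in> H" "g \<in> H" "\<forall>x\<in>dom \<phi>. g x = the (\<phi> x) * f x"
    by (auto simp: pm_E_def)
  have "\<forall>x\<in>dom \<phi>. fun_scale k g x = the (\<phi> x) * fun_scale k f x"
    using g(3) by (simp add: fun_scale_def mult.left_commute)
  then show "fun_scale k f \<in> pm_E H \<phi>"
    unfolding pm_E_def using g(1,2) scale_in by blast
  assume "f' \<in> pm_E H \<phi>"
  then obtain g' where "f' \<in> H" "g' \<in> H" "\<forall>x\<in>dom \<phi>. g' x = the (\<phi> x) * f' x"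
    by (auto simp: pm_E_def)
  moreover from this have "\<forall>x\<in>dom \<phi>. (g + g') x = the (\<phi> x) * (f + f') x"
    using g(3) by (simp add: distrib_left)
  ultimately show "f + f' \<in> pm_E H \<phi>"
    unfolding pm_E_def using g(1,2) add_in by blast
qed

text \<open>
  Normalised definable vectors with values tending to infinity have a convergent subsequence:
  their inner products with \<open>E\<close> decay uniformly, and \<open>E\<close> has finite codimension. Normalising is what
  keeps the limit away from \<open>0\<close>.
\<close>

lemma polar_vector_if_unbounded:
  assumes pm: "pseudomultiplier \<Omega> H ip \<phi>"
    and unbdd: "\<not> bounded (vector_value \<Omega> H ip \<phi> ` definable_vectors \<Omega> H ip \<phi>)"
  obtains q where "polar_vector \<Omega> H ip \<phi> q"
proof -
  let ?val = "vector_value \<Omega> H ip \<phi>" and ?D = "definable_vectors \<Omega> H ip \<phi>"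
  let ?E = "pm_E H \<phi>"
  have "\<exists>d\<in>?D. cmod (?val d) > real n" for n
    using unbdd by (force simp: bounded_iff not_le)
  then obtain d0 where d0: "\<And>n. d0 n \<in> ?D" "\<And>n. cmod (?val (d0 n)) > real n"
    by metis
  have d0H: "d0 n \<in> H" "d0 n \<noteq> 0" for n
    using d0(1)[of n] by (auto simp: definable_vectors_def)
  define d where "d n = fun_scale (of_real (inverse (hnorm (d0 n)))) (d0 n)" for n
  define c where "c n = ?val (d n)" for n
  have sc: "of_real (inverse (hnorm (d0 n))) \<noteq> (0::complex)" for n
    using d0H[of n] by simp
  have dD: "d n \<in> ?D" and c: "cmod (c n) > real n" for n
    using definable_scale[OF pm d0(1) sc, of n n] d0(2) by (auto simp: d_def c_def)
  have dH: "d n \<in> H" and d1: "hnorm (d n) = 1" for n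
    using d0H[of n] by (simp_all add: d_def hnorm_scale norm_inverse del: of_real_inverse)
  have clo: "closedin met.mtopology ?E" and "finite_codim H ?E"
    using pm unfolding pseudomultiplier_def hfs_topology_eq by auto
  then obtain B where B: "finite B" "B \<subseteq> H" "cfun.span (?E \<union> B) = H"
    unfolding finite_codim_def by blast
  have EH: "h \<in> H" if "h \<in> ?E" for h using that by (simp add: pm_E_def)
  \<comment> \<open>The inner product is conjugate linear in the second argument, so scaling \<open>d\<^sub>n\<close> by the conjugate of
    \<open>c\<^sub>n\<close> represents the functional \<open>c\<^sub>n \<langle>\<cdot>, d\<^sub>n\<rangle>\<close>.\<close>
  have "\<exists>M. \<forall>n. cmod (ip h (fun_scale (cnj (c n)) (d n))) \<le> M" if h: "h \<in> ?E" for h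
  proof -
    obtain g where g: "g \<in> H" "\<forall>x\<in>dom \<phi>. g x = the (\<phi> x) * h x"
      using h by (auto simp: pm_E_def)
    have "ip h (fun_scale (cnj (c n)) (d n)) = ip g (d n)" for n
      using vector_value_sees[OF pm dD, of n] g EH[OF h] dH
      by (simp add: sees_with_value_iff[OF pm] ip_scale_right c_def)
    then show ?thesis
      using Cauchy_Schwarz[OF g(1) dH] by (intro exI[of _ "hnorm g"]) (simp add: d1)
  qed
  then obtain K where K: "K \<ge> 0"
    "\<And>h n. h \<in> ?E \<Longrightarrow> cmod (ip h (fun_scale (cnj (c n)) (d n))) \<le> K * hnorm h"
    using uniform_boundedness[OF clo pm_E_subspace, of "\<lambda>n. fun_scale (cnj (c n)) (d n)"] dH
    by blast
  have decay: "real n * cmod (ip h (d n)) \<le> K * hnorm h" if h: "h \<in> ?E" for h n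
  proof -
    have "real n * cmod (ip h (d n)) \<le> cmod (c n) * cmod (ip h (d n))"
      using c[of n] by (intro mult_right_mono) auto
    then show ?thesis
      using K(2)[OF h, of n] EH[OF h] dH by (simp add: ip_scale_right norm_mult)
  qed
  have "uniformly_weakly_Cauchy_on ?E d"
    unfolding uniformly_weakly_Cauchy_on_def
  proof (intro allI impI)
    fix \<epsilon> :: real assume \<epsilon>: "\<epsilon> > 0"
    obtain N where N: "real N > 2 * K / \<epsilon>" using reals_Archimedean2 by blast
    have N0: "real N > 0" using N K(1) \<epsilon> by (smt (verit) divide_nonneg_pos)
    have half: "cmod (ip h (d n)) \<le> \<epsilon> / 2 * hnorm h" if h: "h \<in> ?E" and n: "n \<ge> N" for h n
    proof -
      have "real N * cmod (ip h (d n)) \<le> real n * cmod (ip h (d n))"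
        using n by (intro mult_right_mono) auto
      also have "\<dots> \<le> K * hnorm h" by (rule decay[OF h])
      also have "\<dots> \<le> (real N * (\<epsilon> / 2)) * hnorm h"
        using N \<epsilon> EH[OF h] by (intro mult_right_mono) (auto simp: field_simps)
      finally show ?thesis using N0 by (simp add: mult.assoc)
    qed
    have "cmod (ip h (d m - d n)) \<le> \<epsilon> * hnorm h" if "m \<ge> N" "n \<ge> N" and h: "h \<in> ?E" for m n h
    proof -
      have "cmod (ip h (d m - d n)) \<le> cmod (ip h (d m)) + cmod (ip h (d n))"
        using EH[OF h] dH by (simp add: ip_diff_right norm_triangle_ineq4)
      then show ?thesis using half[OF h that(1)] half[OF h that(2)] by (simp add: field_simps)
    qed
    then show "\<exists>N. \<forall>m\<ge>N. \<forall>n\<ge>N. \<forall>h\<in>?E. cmod (ip h (d m - d n)) \<le> \<epsilon> * hnorm h" by blast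
  qed
  then obtain r q where r: "strict_mono r" and q: "limitin met.mtopology (d \<circ> r) q sequentially"
    using finite_codim_convergent_subsequence[OF B(1) clo pm_E_subspace B(2,3),
        where d = d and C = 1] dH d1
    by auto
  have qH: "q \<in> H" and lim: "(\<lambda>n. hnorm ((d \<circ> r) n - q)) \<longlonglongrightarrow> 0"
    using q limitin_iff_hnorm[of "d \<circ> r" q] dH by auto
  have "q \<noteq> 0"
  proof
    assume "q = 0"
    then have "(\<lambda>n::nat. 1::real) \<longlonglongrightarrow> 0" using lim d1 by simp
    then show False using LIMSEQ_unique tendsto_const zero_neq_one by metis
  qed
  moreover have "filterlim (\<lambda>n. ?val ((d \<circ> r) n)) at_infinity sequentially"
    unfolding filterlim_at_infinity[OF order_refl] eventually_sequentially
  proof (intro allI impI)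
    fix R :: real
    obtain N where N: "real N \<ge> R" using real_arch_simple by blast
    have "R \<le> cmod (?val ((d \<circ> r) n))" if "n \<ge> N" for n
      using N that c[of "r n"] seq_suble[OF r, of n] by (simp add: c_def)
    then show "\<exists>N. \<forall>n\<ge>N. R \<le> norm (?val ((d \<circ> r) n))" by blast
  qed
  ultimately have "polar_vector \<Omega> H ip \<phi> q"
    unfolding polar_vector_def hfs_topology_eq using qH q dD
    by (intro conjI exI[of _ "d \<circ> r"]) auto
  then show ?thesis using that by blast
qed

lemma locally_bounded_imp_no_polar_vector:
  assumes lb: "locally_bounded_on \<Omega> H ip \<phi>
      (hfs_topology H ip closure_of definable_vectors \<Omega> H ip \<phi>)"
  shows "\<not> polar_vector \<Omega> H ip \<phi> q"
proof
  let ?val = "vector_value \<Omega> H ip \<phi>" and ?D = "definable_vectors \<Omega> H ip \<phi>"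
  assume "polar_vector \<Omega> H ip \<phi> q"
  then obtain d where dD: "\<And>n. d n \<in> ?D" and q: "limitin (hfs_topology H ip) d q sequentially"
    and inf: "filterlim (\<lambda>n. ?val (d n)) at_infinity sequentially"
    unfolding polar_vector_def by blast
  have "?D \<subseteq> topspace (hfs_topology H ip)"
    by (auto simp: hfs_topology_eq definable_vectors_def)
  then have "q \<in> hfs_topology H ip closure_of ?D"
    using limitin_closedin[OF q closedin_closure_of, of ?D] dD closure_of_subset
    by (metis (no_types, lifting) eventuallyI subsetD trivial_limit_sequentially)
  then obtain U where U: "openin (hfs_topology H ip) U" "q \<in> U" "bounded (?val ` (U \<inter> ?D))"
    using lb unfolding locally_bounded_on_def by blast
  then obtain R where R: "\<And>x. x \<in> U \<inter> ?D \<Longrightarrow> cmod (?val x) \<le> R"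
    by (auto simp: bounded_iff)
  have "eventually (\<lambda>n. d n \<in> U) sequentially" using q U(1,2) by (auto simp: limitin_def)
  moreover have "eventually (\<lambda>n. max 1 (R + 1) \<le> cmod (?val (d n))) sequentially"
    using inf unfolding filterlim_at_infinity[OF order_refl]
    by (metis less_max_iff_disj zero_less_one)
  ultimately have "eventually (\<lambda>n. False) sequentially"
    by eventually_elim (use R dD in force)
  then show False by simp
qed

end

theorem theorem2p20:
  fixes \<Omega> :: "'a set"
    and H :: "('a \<Rightarrow> complex) set"
    and ip :: "('a \<Rightarrow> complex) \<Rightarrow> ('a \<Rightarrow> complex) \<Rightarrow> complex"
    and \<phi> :: "'a \<rightharpoonup> complex"
  assumes "hilbert_function_space \<Omega> H ip"
    and "pseudomultiplier \<Omega> H ip \<phi>"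
  shows "locally_bounded_on \<Omega> H ip \<phi>
           (hfs_topology H ip closure_of definable_vectors \<Omega> H ip \<phi>)
         \<longleftrightarrow> \<not> (\<exists>q. polar_vector \<Omega> H ip \<phi> q)"
proof -
  interpret hilbert_function_space \<Omega> H ip by fact
  show ?thesis
  proof
    \<comment> \<open>Without polar vectors the whole space is a neighbourhood on which the values are bounded.\<close>
    assume "\<not> (\<exists>q. polar_vector \<Omega> H ip \<phi> q)"
    then have "bounded (vector_value \<Omega> H ip \<phi> ` definable_vectors \<Omega> H ip \<phi>)"
      using polar_vector_if_unbounded[OF assms(2)] by blast
    then have "bounded (vector_value \<Omega> H ip \<phi> ` (H \<inter> definable_vectors \<Omega> H ip \<phi>))"
      by (rule bounded_subset) auto
    moreover have "openin (hfs_topology H ip) H"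
      using openin_topspace[of met.mtopology] by (simp add: hfs_topology_eq)
    moreover have "hfs_topology H ip closure_of definable_vectors \<Omega> H ip \<phi> \<subseteq> H"
      using closure_of_subset_topspace[of met.mtopology] by (simp add: hfs_topology_eq)
    ultimately show "locally_bounded_on \<Omega> H ip \<phi>
        (hfs_topology H ip closure_of definable_vectors \<Omega> H ip \<phi>)"
      unfolding locally_bounded_on_def by blast
  qed (use locally_bounded_imp_no_polar_vector in blast)
qed

end
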